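(* For a positive integer $d$, let $w(d)$ be the largest number with the property that whenever $\mathcal{G}$ is a family of $2d+1$ convex sets in $\mathbb{R}^d$ such that any $2d$ members of $\mathcal{G}$ have an intersection of volume at least $1$, then $\mathrm{vol}(\bigcap_{C\in\mathcal{G}}C)\ge w(d)$. Then for every positive integer $d$ and every $\varepsilon>0$ there exists $c_0=c_0(d,\varepsilon)>0$ such that the following holds: if $\alpha\in(0,1]$ and $\mathcal{F}$ is a family of $n$ convex sets in $\mathbb{R}^d$ such that at least $\alpha\binom{n}{2d}$ of the $2d$-element subfamilies of $\mathcal{F}$ have an intersection of volume at least $1$, then there are at least $c_0\alpha n$ members of $\mathcal{F}$ whose common intersection has volume at least $(1-\varepsilon)w(d)$.
   Context: $\mathrm{vol}$ denotes $d$-dimensional Lebesgue measure.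
   Formalization: The formal statement additionally assumes n ≥ 2d; for 1 ≤ n < 2d there are no 2d-element subfamilies, so the hypothesis is vacuous and the claim fails, e.g. for a family consisting of a single point. *)

theory Defs
  imports "HOL-Analysis.Analysis"
begin

text \<open>Volume = Lebesgue measure on the euclidean space 'a (dimension DIM('a)),
  taken in ennreal so that unbounded convex sets have infinite volume.
  A family of m sets is an indexed family G :: nat \<Rightarrow> 'a set on {..<m}
  (repetitions allowed); subfamilies correspond to index subsets.\<close>

definition helly_vol_const :: "'a::euclidean_space itself \<Rightarrow> real" where
  "helly_vol_const _ = Sup {w::real. \<forall>G :: nat \<Rightarrow> 'a set.
      ((\<forall>i<2 * DIM('a) + 1. convex (G i)) \<and>
       (\<forall>I. I \<subseteq> {..<2 * DIM('a) + 1} \<and> card I = 2 * DIM('a) \<longrightarrow>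
            emeasure lebesgue (\<Inter>i\<in>I. G i) \<ge> 1))
      \<longrightarrow> emeasure lebesgue (\<Inter>i\<in>{..<2 * DIM('a) + 1}. G i) \<ge> ennreal w}"

end

theory Submission
  imports Defs
begin

text \<open>Let \<open>v\<close> be slightly smaller than \<open>w(d)\<close>. A good \<open>2d\<close>-tuple \<open>T\<close>, with intersection \<open>K\<^sub>T\<close>, is
  cut by a ball \<open>B\<close> around the origin down to volume exactly \<open>v\<close>. By the definition of \<open>w(d)\<close>, applied to
  \<open>T\<close> and \<open>B\<close>, some \<open>2d - 1\<close> members \<open>S\<close> of \<open>T\<close> satisfy \<open>vol (K\<^sub>S \<inter> B) < 1\<close>. By pigeonhole a number
  of order \<open>\<alpha> n\<close> of good tuples \<open>S \<union> {x}\<close> share the same \<open>S\<close>; with the largest of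
  their balls, all the sets \<open>K\<^sub>T \<inter> B\<close> are convex of volume at least \<open>v\<close> inside the one set
  \<open>K\<^sub>S \<inter> B\<close> of volume at most 1. Convex subsets of volume at least \<open>v\<close> of such a set fall
  into boundedly many classes, according to which points of a net of bounded size they come close to,
  and the members of one class all contain a common set of volume almost \<open>v\<close>.\<close>

section \<open>Difference bodies\<close>

text \<open>Repetitions pad a set of at most \<open>n + 1\<close> points to exactly
  \<open>n + 1\<close> terms, so that the barycentre used with Helly's theorem always has
  \<open>d + 1\<close> terms.\<close>

lemma finite_image_atMost:
  assumes "finite X" "X \<noteq> {}" "card X \<le> Suc n"
  obtains f :: "nat \<Rightarrow> 'b" where "f ` {..n} = X"
proof -
  obtain g where g: "bij_betw g {0..<card X} X"
    using ex_bij_betw_nat_finite[OF assms(1)] by blast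
  have pos: "0 < card X"
    using assms by (simp add: card_gt_0_iff)
  have img: "g ` {0..<card X} = X"
    using g by (simp add: bij_betw_def)
  have "(\<lambda>i. if i < card X then g i else g 0) ` {..n} = X"
  proof
    show "(\<lambda>i. if i < card X then g i else g 0) ` {..n} \<subseteq> X"
      using img pos by auto
    show "X \<subseteq> (\<lambda>i. if i < card X then g i else g 0) ` {..n}"
    proof
      fix x assume "x \<in> X"
      then obtain i where "i < card X" "x = g i"
        using img by (metis atLeastLessThan_iff imageE)
      then show "x \<in> (\<lambda>i. if i < card X then g i else g 0) ` {..n}"
        using assms(3) by (intro image_eqI[of _ _ i]) auto
    qed
  qed
  then show ?thesis
    by (rule that)
qed

lemma convex_average:
  fixes f :: "'b \<Rightarrow> 'a::real_vector"
  assumes "convex L" "finite I" "I \<noteq> {}" "\<And>i. i \<in> I \<Longrightarrow> f i \<in> L"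
  shows "(1 / real (card I)) *\<^sub>R sum f I \<in> L"
proof -
  have "(\<Sum>i\<in>I. (1 / real (card I)) *\<^sub>R f i) \<in> L"
    using assms by (intro convex_sum) auto
  then show ?thesis
    by (simp add: scaleR_sum_right)
qed

text \<open>Helly's theorem yields a point common to the sets \<open>(x + d L) / (d + 1)\<close> for \<open>x \<in> L\<close>, because
  the barycentre of \<open>d + 1\<close> points of \<open>L\<close> lies in all of the corresponding sets.\<close>

lemma difference_body_homothet_subset:
  fixes L :: "'a::euclidean_space set"
  assumes L: "compact L" "convex L" "L \<noteq> {}"
  obtains c where "\<And>x y. x \<in> L \<Longrightarrow> y \<in> L \<Longrightarrow> c + (1 / real (DIM('a) + 1)) *\<^sub>R (x - y) \<in> L"
proof -
  define d where "d = DIM('a)"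
  have d: "d > 0"
    by (simp add: d_def)
  define A where "A x = (\<lambda>l. (1 / real (d + 1)) *\<^sub>R x + (real d / real (d + 1)) *\<^sub>R l) ` L" for x
  have conv: "convex (A x)" and comp: "compact (A x)" for x
    unfolding A_def using L by (auto intro: convex_affinity compact_affinity)
  have small: "\<Inter>(A ` X) \<noteq> {}" if X: "finite X" "X \<noteq> {}" "card X \<le> Suc d" "X \<subseteq> L" for X
  proof -
    obtain f where f: "f ` {..d} = X"
      using finite_image_atMost[OF X(1-3)] by blast
    define c where "c = (1 / real (d + 1)) *\<^sub>R sum f {..d}"
    have "c \<in> A (f j)" if j: "j \<le> d" for j
    proof -
      have card: "card ({..d} - {j}) = d"
        using j by simp
      then have "{..d} - {j} \<noteq> {}"
        using d by (metis card.empty less_irrefl)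
      then have "(1 / real d) *\<^sub>R sum f ({..d} - {j}) \<in> L"
        using convex_average[OF L(2), of "{..d} - {j}" f] X f unfolding card by blast
      \<comment> \<open>Splitting off \<open>f j\<close> from the barycentre leaves the average of
        the other \<open>d\<close> terms, a point of \<open>L\<close>, with weight
        \<open>d / (d + 1)\<close>.\<close>
      moreover have "c = (1 / real (d + 1)) *\<^sub>R f j
          + (real d / real (d + 1)) *\<^sub>R ((1 / real d) *\<^sub>R sum f ({..d} - {j}))"
        using j d by (simp add: c_def sum.remove[of "{..d}" j] scaleR_add_right)
      ultimately show ?thesis
        unfolding A_def by blast
    qed
    then have "c \<in> \<Inter>(A ` X)"
      using f by auto
    then show ?thesis
      by blast
  qed
  have fin: "\<Inter>(A ` X) \<noteq> {}" if X: "finite X" "X \<noteq> {}" "X \<subseteq> L" for X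
  proof -
    \<comment> \<open>Different points of \<open>X\<close> may give the same set, so a subfamily is
      pulled back to equally many points. Families with fewer than \<open>d + 1\<close> sets fall
      outside \<open>Helly\<close> and are settled by \<open>small\<close>.\<close>
    have sub: "\<exists>Y. Y \<subseteq> X \<and> A ` Y = t \<and> card Y = card t" if "t \<subseteq> A ` X" for t
      using that by (metis subset_image_inj card_image)
    show ?thesis
    proof (cases "card (A ` X) \<ge> d + 1")
      case True
      show ?thesis
      proof (rule Helly)
        show "card (A ` X) \<ge> DIM('a) + 1"
          using True by (simp add: d_def)
        show "\<Inter>t \<noteq> {}" if "t \<subseteq> A ` X" "card t = DIM('a) + 1" for t
          using sub[OF that(1)] small that X
          by (metis Suc_eq_plus1 card.empty d_def finite_subset le_refl nat.distinct(1) subset_trans)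
      qed (use conv in auto)
    next
      case False
      obtain Y where Y: "Y \<subseteq> X" "A ` Y = A ` X" "card Y = card (A ` X)"
        using sub[of "A ` X"] by auto
      have "\<Inter>(A ` Y) \<noteq> {}"
        using Y X False by (intro small) (auto intro: finite_subset)
      then show ?thesis
        using Y by simp
    qed
  qed
  obtain x0 where x0: "x0 \<in> L"
    using L by blast
  \<comment> \<open>The single set \<open>A x0\<close> is the compact set in which the finite
    intersection property is applied to the closed sets \<open>A x\<close>.\<close>
  have "A x0 \<inter> (\<Inter>x\<in>L. A x) \<noteq> {}"
  proof (rule compact_imp_fip_image)
    show "A x0 \<inter> (\<Inter>x\<in>I. A x) \<noteq> {}" if "finite I" "I \<subseteq> L" for I
      using fin[of "insert x0 I"] that x0 by auto
  qed (use comp compact_imp_closed in auto)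
  then obtain c where c: "\<And>x. x \<in> L \<Longrightarrow> c \<in> A x"
    by blast
  show ?thesis
  proof
    fix x y assume xy: "x \<in> L" "y \<in> L"
    obtain l where l: "l \<in> L" "c = (1 / real (d + 1)) *\<^sub>R y + (real d / real (d + 1)) *\<^sub>R l"
      using c[OF xy(2)] by (auto simp: A_def)
    \<comment> \<open>Replacing \<open>y\<close> by \<open>x\<close> in the formula for
      \<open>c\<close> moves the point by exactly \<open>(x - y) / (d + 1)\<close>.\<close>
    have "(1 / real (d + 1)) *\<^sub>R x + (real d / real (d + 1)) *\<^sub>R l \<in> L"
      using xy l by (intro convexD[OF L(2)]) (auto simp: field_simps)
    then show "c + (1 / real (DIM('a) + 1)) *\<^sub>R (x - y) \<in> L"
      by (simp add: l d_def algebra_simps)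
  qed
qed

text \<open>The disjoint sets \<open>z + t L\<close> all lie in \<open>(1 + t) K\<close>.\<close>

lemma packing_bound:
  fixes K :: "'a::euclidean_space set"
  assumes K: "convex K" "bounded K" and L: "convex L" "L \<subseteq> K"
    and Z: "finite Z" "Z \<subseteq> K" and t: "0 \<le> t"
    and disj: "\<And>z z' l l'. z \<in> Z \<Longrightarrow> z' \<in> Z \<Longrightarrow> z \<noteq> z' \<Longrightarrow> l \<in> L \<Longrightarrow> l' \<in> L \<Longrightarrow>
                 z + t *\<^sub>R l \<noteq> z' + t *\<^sub>R l'"
  shows "real (card Z) * (t ^ DIM('a) * measure lebesgue L)
           \<le> (1 + t) ^ DIM('a) * measure lebesgue K"
proof -
  define B where "B z = (\<lambda>l. t *\<^sub>R l + z) ` L" for z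
  have bL: "bounded L"
    using K L bounded_subset by blast
  have B: "B z \<in> lmeasurable" for z
    unfolding B_def using L bL
    using convex_affinity[of L z t] bounded_translation[OF bounded_scaling[OF bL], of z t]
    by (intro measurable_convex) (simp_all add: add.commute[of _ z] image_image)
  have mB: "measure lebesgue (B z) = t ^ DIM('a) * measure lebesgue L" for z
    unfolding B_def using t by (simp add: measure_lebesgue_affine)
  define K' where "K' = (\<lambda>x. (1 + t) *\<^sub>R x + 0) ` K"
  have K': "K' \<in> lmeasurable"
    unfolding K'_def using K
    by (intro measurable_convex) (auto intro: convex_scaling bounded_scaling)
  have sub: "B z \<subseteq> K'" if "z \<in> Z" for z
  proof
    fix y assume "y \<in> B z"
    then obtain l where l: "l \<in> L" "y = t *\<^sub>R l + z"
      by (auto simp: B_def)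
    have "(t / (1 + t)) *\<^sub>R l + (1 / (1 + t)) *\<^sub>R z \<in> K"
      using l L Z that t by (intro convexD[OF K(1)]) (auto simp: field_simps)
    moreover have "y = (1 + t) *\<^sub>R ((t / (1 + t)) *\<^sub>R l + (1 / (1 + t)) *\<^sub>R z) + 0"
      using l t by (simp add: scaleR_add_right)
    ultimately show "y \<in> K'"
      unfolding K'_def by blast
  qed
  have "real (card Z) * (t ^ DIM('a) * measure lebesgue L) = (\<Sum>z\<in>Z. measure lebesgue (B z))"
    by (simp add: mB)
  also have "\<dots> = measure lebesgue (\<Union>z\<in>Z. B z)"
    using Z B disj
    by (intro measure_UNION'[symmetric])
       (fastforce simp: pairwise_def disjnt_iff B_def add.commute)+
  also have "\<dots> \<le> measure lebesgue K'"
    using sub B K' Z by (intro measure_mono_fmeasurable) (auto intro!: sets.finite_UN)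
  also have "\<dots> = (1 + t) ^ DIM('a) * measure lebesgue K"
    unfolding K'_def using t by (subst measure_lebesgue_affine) simp
  finally show ?thesis .
qed


text \<open>Divide the segment from \<open>y\<close> to \<open>x\<close> into \<open>N\<close> equal parts: for lack of volume in \<open>2 K\<close>, the translates
  of \<open>L\<close> by two of the division points intersect.\<close>

lemma difference_body_subset_scaled:
  fixes K :: "'a::euclidean_space set"
  assumes K: "convex K" "bounded K" and L: "convex L" "L \<subseteq> K" and N: "N > 0"
    and vol: "2 ^ DIM('a) * measure lebesgue K < real (N + 1) * measure lebesgue L"
    and xy: "x \<in> K" "y \<in> K"
  obtains a b where "a \<in> L" "b \<in> L" "x - y = real N *\<^sub>R (a - b)"
proof (cases "x = y")
  case True
  have "0 \<le> 2 ^ DIM('a) * measure lebesgue K"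
    by simp
  with vol have "L \<noteq> {}"
    by (metis less_le_not_le measure_empty mult_zero_right)
  with True that show ?thesis
    by fastforce
next
  case False
  define z where "z k = y + (real k / real N) *\<^sub>R (x - y)" for k
  have inj: "inj_on z {..N}"
    using False N by (auto simp: inj_on_def z_def)
  have zK: "z k \<in> K" if "k \<le> N" for k
  proof -
    have "(1 - real k / real N) *\<^sub>R y + (real k / real N) *\<^sub>R x \<in> K"
      using that N xy by (intro convexD[OF K(1)]) auto
    then show ?thesis
      by (simp add: z_def algebra_simps)
  qed
  \<comment> \<open>Otherwise the \<open>N + 1\<close> translates of \<open>L\<close> would be
    pairwise disjoint, and \<open>packing_bound\<close> with \<open>t = 1\<close> would contradict
    \<open>vol\<close>.\<close>
  have "\<exists>i j l l'. i < j \<and> j \<le> N \<and> l \<in> L \<and> l' \<in> L \<and> z i + l = z j + l'"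
  proof (rule ccontr)
    assume no: "\<not> ?thesis"
    have "z i + 1 *\<^sub>R l \<noteq> z j + 1 *\<^sub>R l'"
      if "i \<le> N" "j \<le> N" "z i \<noteq> z j" "l \<in> L" "l' \<in> L" for i j l l'
      using no that by (metis linorder_neqE_nat scaleR_one)
    then have "real (card (z ` {..N})) * (1 ^ DIM('a) * measure lebesgue L)
        \<le> (1 + 1) ^ DIM('a) * measure lebesgue K"
      using zK by (intro packing_bound K L) auto
    then show False
      using vol by (simp add: card_image[OF inj])
  qed
  then obtain i j l l' where ij: "i < j" "j \<le> N" and l: "l \<in> L" "l' \<in> L"
    and eq: "z i + l = z j + l'"
    by blast
  \<comment> \<open>The collision gives \<open>l - l' = ((j - i) / N) (x - y)\<close>. Shrinking by
    \<open>u\<close> towards \<open>l'\<close> makes the factor \<open>1 / N\<close>, and the shrunk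
    point stays in \<open>L\<close> because \<open>j - i\<close> is at least 1.\<close>
  define u where "u = 1 / (real j - real i)"
  have u: "0 < u" "u \<le> 1"
    using ij by (auto simp: u_def)
  have ll: "l - l' = ((real j - real i) / real N) *\<^sub>R (x - y)"
    using eq by (simp add: z_def algebra_simps diff_divide_distrib)
  have "l' + u *\<^sub>R (l - l') \<in> L"
    using convexD[OF L(1) l(1) l(2), of u "1 - u"] u by (simp add: algebra_simps)
  moreover have "x - y = real N *\<^sub>R (l' + u *\<^sub>R (l - l') - l')"
    using ij N by (simp add: ll u_def)
  ultimately show ?thesis
    using l that by blast
qed

text \<open>\<open>Z\<close> is a largest set of points of \<open>K\<close> whose translates
  \<open>z + t K\<close> are pairwise disjoint. \<open>packing_bound\<close> limits its size, and by
  maximality the translate at any further \<open>y\<close> meets one of them.\<close>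

lemma difference_body_net:
  fixes K :: "'a::euclidean_space set"
  assumes K: "convex K" "bounded K" "measure lebesgue K > 0" and t: "0 < t"
  obtains Z where "finite Z" "Z \<subseteq> K" "real (card Z) \<le> ((1 + t) / t) ^ DIM('a)"
    "\<And>y. y \<in> K \<Longrightarrow> \<exists>z\<in>Z. \<exists>a\<in>K. \<exists>b\<in>K. y - z = t *\<^sub>R (a - b)"
proof -
  define P where "P Z \<longleftrightarrow> finite Z \<and> Z \<subseteq> K \<and>
    (\<forall>z\<in>Z. \<forall>z'\<in>Z. z \<noteq> z' \<longrightarrow> (\<forall>l\<in>K. \<forall>l'\<in>K. z + t *\<^sub>R l \<noteq> z' + t *\<^sub>R l'))" for Z
  have bound: "real (card Z) \<le> ((1 + t) / t) ^ DIM('a)" if "P Z" for Z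
  proof -
    have "real (card Z) * (t ^ DIM('a) * measure lebesgue K) \<le> (1 + t) ^ DIM('a) * measure lebesgue K"
      using that t K unfolding P_def by (intro packing_bound) auto
    then show ?thesis
      using K(3) t by (simp add: power_divide field_simps)
  qed
  have "P {}"
    by (simp add: P_def)
  moreover have "\<forall>Z. P Z \<longrightarrow> card Z < nat \<lfloor>((1 + t) / t) ^ DIM('a)\<rfloor> + 1"
    using bound by (auto simp: less_Suc_eq_le le_nat_floor)
  ultimately obtain Z where Z: "P Z" and max: "\<And>Z'. P Z' \<Longrightarrow> card Z' \<le> card Z"
    using ex_has_greatest_nat[of P "{}" card] by blast
  have "\<exists>z\<in>Z. \<exists>a\<in>K. \<exists>b\<in>K. y - z = t *\<^sub>R (a - b)" if y: "y \<in> K" for y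
  proof (cases "y \<in> Z")
    case True
    with y show ?thesis
      by (intro bexI[of _ y]) auto
  next
    case False
    have fin: "finite Z"
      using Z by (simp add: P_def)
    have "\<not> P (insert y Z)"
      using max[of "insert y Z"] False fin by auto
    then have "\<exists>w\<in>insert y Z. \<exists>w'\<in>insert y Z. w \<noteq> w' \<and> (\<exists>l\<in>K. \<exists>l'\<in>K. w + t *\<^sub>R l = w' + t *\<^sub>R l')"
      using Z y unfolding P_def by (meson finite_insert insert_subset)
    then obtain w w' l l' where w: "w \<in> insert y Z" "w' \<in> insert y Z" "w \<noteq> w'" "l \<in> K" "l' \<in> K"
      "w + t *\<^sub>R l = w' + t *\<^sub>R l'"
      by blast
    moreover have "\<not> (w \<in> Z \<and> w' \<in> Z)"
      using Z w unfolding P_def by blast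
    ultimately consider "w = y" "w' \<in> Z" | "w' = y" "w \<in> Z"
      by blast
    then show ?thesis
    proof cases
      case 1
      then have "y - w' = t *\<^sub>R (l' - l)"
        using w(6) by (simp add: algebra_simps)
      with 1 w show ?thesis
        by blast
    next
      case 2
      then have "y - w = t *\<^sub>R (l - l')"
        using w(6) by (simp add: algebra_simps)
      with 2 w show ?thesis
        by blast
    qed
  qed
  then show ?thesis
    using that Z bound unfolding P_def by blast
qed

text \<open>If \<open>p\<close> is not in \<open>L\<close>, a separating functional exceeds its
  value at \<open>p\<close> by a fixed gap on all of \<open>L\<close>. For \<open>e\<close> in
  \<open>D\<close> within this gap of the infimum over \<open>D\<close>, its value at
  \<open>p + e\<close> is below all its values on \<open>L + D\<close>.\<close>

lemma minkowski_cancel: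
  fixes L :: "'a::euclidean_space set"
  assumes L: "convex L" "closed L" and D: "bounded D" "D \<noteq> {}"
    and sub: "\<And>e. e \<in> D \<Longrightarrow> \<exists>l\<in>L. \<exists>e'\<in>D. p + e = l + e'"
  shows "p \<in> L"
proof (rule ccontr)
  assume "p \<notin> L"
  then obtain a b where ab: "inner a p < b" "\<And>x. x \<in> L \<Longrightarrow> b < inner a x"
    using separating_hyperplane_closed_point[OF L] by blast
  define m where "m = Inf (inner a ` D)"
  have bdd: "bdd_below (inner a ` D)"
    using D(1) by (intro bounded_imp_bdd_below bounded_linear_image bounded_linear_inner_right)
  have "m < m + (b - inner a p)"
    using ab by simp
  then obtain e where e: "e \<in> D" "inner a e < m + (b - inner a p)"
    unfolding m_def using cInf_lessD[of "inner a ` D"] D(2) by blast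
  obtain l e' where l: "l \<in> L" "e' \<in> D" "p + e = l + e'"
    using sub[OF e(1)] by blast
  have "inner a p + inner a e = inner a l + inner a e'"
    using l(3) by (metis inner_add_right)
  moreover have "m \<le> inner a e'"
    unfolding m_def using bdd l by (intro cInf_lower) auto
  ultimately show False
    using e ab(2)[OF l(1)] by linarith
qed

section \<open>Large convex subsets of a convex set of bounded volume\<close>

text \<open>With \<open>N = \<lceil>2\<^sup>d / v\<rceil>\<close>, every convex \<open>L \<subseteq> K\<close> of volume at least \<open>v\<close> satisfies \<open>K - K \<subseteq> N (L - L)\<close>;
  the scale \<open>t\<close> is chosen such that some translate of \<open>2 t (K - K)\<close> fits into \<open>s L\<close>.\<close>

definition net_size :: "nat \<Rightarrow> real \<Rightarrow> real \<Rightarrow> nat" where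
  "net_size d v s =
     (let t = s / (2 * real (nat \<lceil>2 ^ d / v\<rceil>) * (real d + 1)) in nat \<lfloor>((1 + t) / t) ^ d\<rfloor>)"

text \<open>If \<open>L\<^sub>0\<close> and \<open>L\<close> are close to the same points of the net, then \<open>L\<^sub>0 \<subseteq> L + D\<close> for \<open>D = 2 t (K - K)\<close>,
  while \<open>(1 - s) L\<^sub>0 + s c + D \<subseteq> L\<^sub>0\<close>; cancelling \<open>D\<close> shows that \<open>(1 - s) L\<^sub>0 + s c\<close> lies in \<open>L\<close>.\<close>

lemma positive_fraction_large_intersection:
  fixes K :: "'a::euclidean_space set" and L :: "'i \<Rightarrow> 'a set"
  assumes v: "0 < v" and s: "0 < s" "s < 1"
    and K: "compact K" "convex K" "measure lebesgue K \<le> 1" and I: "finite I" "I \<noteq> {}"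
    and L: "\<And>i. i \<in> I \<Longrightarrow> compact (L i)" "\<And>i. i \<in> I \<Longrightarrow> convex (L i)"
      "\<And>i. i \<in> I \<Longrightarrow> L i \<subseteq> K" "\<And>i. i \<in> I \<Longrightarrow> v \<le> measure lebesgue (L i)"
  obtains J where "J \<subseteq> I" "J \<noteq> {}" "real (card I) \<le> 2 ^ net_size (DIM('a)) v s * real (card J)"
    "(1 - s) ^ DIM('a) * v \<le> measure lebesgue (\<Inter>i\<in>J. L i)"
proof -
  define d where "d = DIM('a)"
  define N where "N = nat \<lceil>2 ^ d / v\<rceil>"
  have Nge: "2 ^ d / v \<le> real N"
    unfolding N_def by linarith
  have "0 < 2 ^ d / v"
    using v by simp
  with Nge have N: "N > 0"
    by (metis less_le_trans of_nat_0_less_iff)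
  define t where "t = s / (2 * real N * (real d + 1))"
  have t: "0 < t"
    using s N by (simp add: t_def add_pos_nonneg)
  have tN: "2 * t * real N = s / (real d + 1)"
  proof -
    have "2 * (s / (2 * x * q)) * x = s / q" if "x \<noteq> 0" for x q :: real
      using that by simp
    then show ?thesis
      using N by (simp add: t_def)
  qed
  define n where "n = net_size d v s"
  have n: "n = nat \<lfloor>((1 + t) / t) ^ d\<rfloor>"
    by (simp add: n_def net_size_def t_def N_def)
  have bK: "bounded K"
    using K compact_imp_bounded by blast
  obtain i1 where i1: "i1 \<in> I"
    using I by blast
  have "measure lebesgue (L i1) \<le> measure lebesgue K"
    using L i1 K by (intro measure_mono_fmeasurable) (auto intro: lmeasurable_compact fmeasurableD)
  then have vK: "measure lebesgue K > 0"
    using L(4)[OF i1] v by linarith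
  obtain Z where Z: "finite Z" "Z \<subseteq> K" "real (card Z) \<le> ((1 + t) / t) ^ DIM('a)"
    and net: "\<And>y. y \<in> K \<Longrightarrow> \<exists>z\<in>Z. \<exists>a\<in>K. \<exists>b\<in>K. y - z = t *\<^sub>R (a - b)"
    using difference_body_net[OF K(2) bK vK t] by blast
  have cZ: "card Z \<le> n"
    unfolding n d_def using Z(3) by (simp add: le_nat_floor)
  \<comment> \<open>\<open>f i\<close> is the set of net points close to \<open>L i\<close>. It
    takes at most \<open>2 ^ n\<close> values, so some class contains at least the fraction
    \<open>1 / 2 ^ n\<close> of the indices.\<close>
  define f where "f i = {z \<in> Z. \<exists>l\<in>L i. \<exists>a\<in>K. \<exists>b\<in>K. l - z = t *\<^sub>R (a - b)}" for i
  have "\<exists>y\<in>Pow Z. card (f -` {y} \<inter> I) * card (Pow Z) \<ge> card I"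
    using I Z by (intro pigeonhole_card) (auto simp: f_def)
  then obtain y where y: "card (f -` {y} \<inter> I) * card (Pow Z) \<ge> card I"
    by blast
  define J where "J = f -` {y} \<inter> I"
  have "card I \<le> card J * 2 ^ n"
  proof -
    have "card I \<le> card J * 2 ^ card Z"
      using y unfolding J_def card_Pow[OF Z(1)] .
    also have "\<dots> \<le> card J * 2 ^ n"
      using cZ by (intro mult_le_mono2 power_increasing) auto
    finally show ?thesis .
  qed
  then have "real (card I) \<le> real (card J * 2 ^ n)"
    by (simp only: of_nat_le_iff)
  then have cJ: "real (card I) \<le> 2 ^ n * real (card J)"
    by (simp add: mult.commute)
  have "card I > 0"
    using I by (simp add: card_gt_0_iff)
  with \<open>card I \<le> card J * 2 ^ n\<close> have "J \<noteq> {}"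
    by auto
  then obtain i0 where i0: "i0 \<in> J"
    by blast
  have JI: "J \<subseteq> I" and i0I: "i0 \<in> I"
    using i0 by (auto simp: J_def)
  have vL: "measure lebesgue (L i0) > 0"
    using L(4)[OF i0I] v by linarith
  then have "L i0 \<noteq> {}"
    by auto
  then obtain c where c: "\<And>x y. x \<in> L i0 \<Longrightarrow> y \<in> L i0 \<Longrightarrow>
      c + (1 / real (DIM('a) + 1)) *\<^sub>R (x - y) \<in> L i0"
    using difference_body_homothet_subset[OF L(1,2)[OF i0I]] by blast
  \<comment> \<open>The factor 2 covers two errors in \<open>t (K - K)\<close>: from a point of
    \<open>L i0\<close> to the net, and from the net to \<open>L i\<close>.\<close>
  define D where "D = (\<lambda>(x, y). (2 * t) *\<^sub>R (x - y)) ` (K \<times> K)"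
  have DK: "bounded D"
    unfolding D_def
    by (intro compact_imp_bounded compact_continuous_image compact_Times K)
       (auto simp: case_prod_unfold intro!: continuous_intros)
  have D_ne: "D \<noteq> {}"
    using L(3)[OF i0I] \<open>L i0 \<noteq> {}\<close> by (auto simp: D_def)
  have vol: "2 ^ DIM('a) * measure lebesgue K < real (N + 1) * measure lebesgue (L i0)"
  proof -
    have "2 ^ DIM('a) * measure lebesgue K \<le> 2 ^ d"
      using K(3) by (simp add: d_def mult_left_le)
    also have "\<dots> \<le> real N * v"
      using Nge v by (simp add: field_simps)
    also have "\<dots> < real (N + 1) * v"
      using v by simp
    also have "\<dots> \<le> real (N + 1) * measure lebesgue (L i0)"
      using L(4)[OF i0I] by (intro mult_left_mono) auto
    finally show ?thesis .
  qed
  define R where "R = (\<lambda>a. (1 - s) *\<^sub>R a + s *\<^sub>R c) ` L i0"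
  have "R \<subseteq> L i" if i: "i \<in> J" for i
  proof
    fix p assume "p \<in> R"
    then obtain a where a: "a \<in> L i0" "p = (1 - s) *\<^sub>R a + s *\<^sub>R c"
      by (auto simp: R_def)
    show "p \<in> L i"
    proof (rule minkowski_cancel[OF _ _ DK D_ne])
      fix e assume "e \<in> D"
      then obtain x y where xy: "x \<in> K" "y \<in> K" "e = (2 * t) *\<^sub>R (x - y)"
        by (auto simp: D_def)
      obtain a' b' where ab: "a' \<in> L i0" "b' \<in> L i0" "x - y = real N *\<^sub>R (a' - b')"
        using difference_body_subset_scaled[OF K(2) bK L(2,3)[OF i0I] N vol xy(1,2)] by blast
      \<comment> \<open>Since \<open>2 t N = s / (d + 1)\<close>, the point \<open>p + e\<close> is
        a convex combination of \<open>a\<close> and a point of the translated difference body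
        inside \<open>L i0\<close>.\<close>
      have "e = (s / (real d + 1)) *\<^sub>R (a' - b')"
        unfolding xy(3) ab(3) using tN by (metis scaleR_scaleR)
      then have "p + e = (1 - s) *\<^sub>R a + s *\<^sub>R (c + (1 / real (DIM('a) + 1)) *\<^sub>R (a' - b'))"
        by (simp add: a d_def scaleR_add_right)
      also have "\<dots> \<in> L i0"
        using s by (intro convexD[OF L(2)[OF i0I] a(1) c[OF ab(1,2)]]) auto
      finally have pe: "p + e \<in> L i0" .
      obtain z a1 b1 where z: "z \<in> Z" "a1 \<in> K" "b1 \<in> K" "p + e - z = t *\<^sub>R (a1 - b1)"
        using net[of "p + e"] pe L(3)[OF i0I] by blast
      have "z \<in> f i0"
        unfolding f_def using z pe by blast
      also have "f i0 = f i"
        using i i0 by (simp add: J_def)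
      finally obtain l a2 b2 where l: "l \<in> L i" "a2 \<in> K" "b2 \<in> K" "l - z = t *\<^sub>R (a2 - b2)"
        unfolding f_def by blast
      \<comment> \<open>Midpoints turn the sum of the two errors \<open>t (a1 - b1)\<close> and
        \<open>t (b2 - a2)\<close> into one element of \<open>2 t (K - K)\<close>.\<close>
      have mid: "(1/2) *\<^sub>R q + (1/2) *\<^sub>R r \<in> K" if "q \<in> K" "r \<in> K" for q r
        using that by (intro convexD[OF K(2)]) auto
      have "p + e - l = (p + e - z) - (l - z)"
        by simp
      also have "\<dots> = (2 * t) *\<^sub>R (((1/2) *\<^sub>R a1 + (1/2) *\<^sub>R b2) - ((1/2) *\<^sub>R b1 + (1/2) *\<^sub>R a2))"
        unfolding z(4) l(4) by (simp add: algebra_simps)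
      finally have "p + e - l \<in> D"
        unfolding D_def using mid z l by force
      then show "\<exists>l\<in>L i. \<exists>e'\<in>D. p + e = l + e'"
        using l(1) by (intro bexI[of _ l] bexI[of _ "p + e - l"]) auto
    qed (use L(1,2)[of i] i JI compact_imp_closed in blast)+
  qed
  then have R: "R \<subseteq> (\<Inter>i\<in>J. L i)"
    by blast
  have "(1 - s) ^ DIM('a) * v \<le> (1 - s) ^ DIM('a) * measure lebesgue (L i0)"
    using s L(4)[OF i0I] by (intro mult_left_mono) auto
  also have "\<dots> = measure lebesgue R"
    unfolding R_def using s by (subst measure_lebesgue_affine) simp
  also have "\<dots> \<le> measure lebesgue (\<Inter>i\<in>J. L i)"
  proof (rule measure_mono_fmeasurable[OF R])
    have "compact R"
      unfolding R_def using L(1)[OF i0I] by (intro compact_continuous_image continuous_intros)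
    then show "R \<in> sets lebesgue"
      by (intro fmeasurableD lmeasurable_compact)
    have "compact (\<Inter>i\<in>J. L i)"
      using L(1) JI \<open>J \<noteq> {}\<close> by (intro compact_Inter) (auto intro: compact_imp_closed)
    then show "(\<Inter>i\<in>J. L i) \<in> lmeasurable"
      by (rule lmeasurable_compact)
  qed
  finally show ?thesis
    using that[OF JI \<open>J \<noteq> {}\<close>] cJ by (simp add: n_def d_def)
qed

section \<open>Cutting an intersection by a ball\<close>

text \<open>Bounded convex sets are measurable, and balls of integer radius exhaust the
  space.\<close>

lemma convex_set_lebesgue:
  fixes S :: "'a::euclidean_space set"
  assumes "convex S"
  shows "S \<in> sets lebesgue"
proof -
  have "S = (\<Union>n. S \<inter> cball 0 (real n))"
    using real_arch_simple by fastforce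
  moreover have "S \<inter> cball 0 (real n) \<in> sets lebesgue" for n
    using assms by (intro fmeasurableD measurable_convex) (auto intro: convex_Int)
  ultimately show ?thesis
    by (metis (no_types, lifting) sets.countable_UN image_subset_iff)
qed

text \<open>The volume inside the ball is 0 at radius 0, exceeds \<open>v\<close> for a large radius
  and is continuous in the radius, so the intermediate value theorem applies. \<open>K\<close> may
  have infinite volume.\<close>

lemma ex_cball_measure_eq:
  fixes K :: "'a::euclidean_space set"
  assumes K: "convex K" and v: "0 \<le> v" "ennreal v < emeasure lebesgue K"
  obtains r where "0 \<le> r" "measure lebesgue (K \<inter> cball 0 r) = v"
proof -
  define g where "g r = measure lebesgue (K \<inter> cball 0 r)" for r
  define h where "h r = measure lebesgue (cball (0::'a) r)" for r
  have Kr: "K \<inter> cball 0 r \<in> lmeasurable" for r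
    using K by (intro measurable_convex) (auto intro: convex_Int)
  \<comment> \<open>The increase of \<open>g\<close> is at most the volume of a spherical shell, so
    continuity passes from \<open>h\<close> to \<open>g\<close>.\<close>
  have diff: "\<bar>g y - g x\<bar> \<le> \<bar>h y - h x\<bar>" if "x \<le> y" for x y
  proof -
    have sub: "cball (0::'a) x \<subseteq> cball 0 y"
      using that by auto
    have "g y \<le> measure lebesgue ((K \<inter> cball 0 x) \<union> (cball 0 y - cball 0 x))"
      unfolding g_def using Kr
      by (intro measure_mono_fmeasurable) (auto intro!: fmeasurable.Un fmeasurable.Diff)
    also have "\<dots> \<le> g x + measure lebesgue (cball (0::'a) y - cball 0 x)"
      unfolding g_def using Kr by (intro measure_Un_le) auto
    also have "measure lebesgue (cball (0::'a) y - cball 0 x) = h y - h x"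
      unfolding h_def using sub by (intro measurable_measure_Diff) auto
    finally have "g y - g x \<le> h y - h x"
      by simp
    moreover have "g x \<le> g y"
      unfolding g_def using sub Kr by (intro measure_mono_fmeasurable) auto
    ultimately show ?thesis
      by linarith
  qed
  have dist: "dist (g y) (g x) \<le> dist (h y) (h x)" for x y
    using diff[of x y] diff[of y x] by (cases "x \<le> y") (auto simp: dist_real_def)
  have "continuous_on {0..R} (\<lambda>r. unit_ball_vol (DIM('a)) * r ^ DIM('a))" for R :: real
    by (intro continuous_intros)
  then have "continuous_on {0..R} h" for R :: real
    by (rule continuous_on_eq) (auto simp: h_def content_cball)
  then have cont: "continuous_on {0..R} g" for R :: real
    unfolding continuous_on_iff by (meson dist le_less_trans)
  have "(\<lambda>n. emeasure lebesgue (K \<inter> cball 0 (real n))) \<longlonglongrightarrow> emeasure lebesgue (\<Union>n. K \<inter> cball 0 (real n))"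
    using Kr by (intro Lim_emeasure_incseq) (auto simp: incseq_def)
  also have "(\<Union>n. K \<inter> cball 0 (real n)) = K"
    using real_arch_simple by fastforce
  finally have "\<forall>\<^sub>F n in sequentially. ennreal v < emeasure lebesgue (K \<inter> cball 0 (real n))"
    using v(2) order_tendstoD(1) by blast
  then obtain n where "ennreal v < emeasure lebesgue (K \<inter> cball 0 (real n))"
    using eventually_happens trivial_limit_sequentially by blast
  then have "v < g (real n)"
    unfolding g_def using Kr v(1) by (simp add: emeasure_eq_measure2 ennreal_less_iff)
  moreover have "g 0 = 0"
    unfolding g_def
    by (intro negligible_imp_measure0 negligible_subset[OF negligible_sing[of 0]]) auto
  ultimately obtain r where "0 \<le> r" "g r = v"
    using IVT'[of g 0 v "real n"] v(1) cont by auto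
  then show ?thesis
    using that by (simp add: g_def)
qed

section \<open>The constant w(d) and the subfamilies it provides\<close>

definition helly_vol_bounds :: "'a::euclidean_space itself \<Rightarrow> real set" where
  "helly_vol_bounds _ = {w. \<forall>G :: nat \<Rightarrow> 'a set.
      ((\<forall>i<2 * DIM('a) + 1. convex (G i)) \<and>
       (\<forall>I. I \<subseteq> {..<2 * DIM('a) + 1} \<and> card I = 2 * DIM('a) \<longrightarrow>
            emeasure lebesgue (\<Inter>i\<in>I. G i) \<ge> 1))
      \<longrightarrow> emeasure lebesgue (\<Inter>i\<in>{..<2 * DIM('a) + 1}. G i) \<ge> ennreal w}"

lemma helly_vol_const_eq_Sup: "helly_vol_const TYPE('a::euclidean_space) = Sup (helly_vol_bounds TYPE('a))"
  by (simp add: helly_vol_const_def helly_vol_bounds_def)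

lemma zero_in_helly_vol_bounds: "0 \<in> helly_vol_bounds TYPE('a::euclidean_space)"
  by (simp add: helly_vol_bounds_def)

text \<open>Test case: all members equal to the unit cube.\<close>

lemma helly_vol_bounds_le_1:
  assumes "w \<in> helly_vol_bounds TYPE('a::euclidean_space)"
  shows "w \<le> 1"
proof -
  define G :: "nat \<Rightarrow> 'a set" where "G i = cbox 0 One" for i
  have G: "emeasure lebesgue (\<Inter>i\<in>I. G i) = 1" if "I \<noteq> {}" for I
    using that by (simp add: G_def emeasure_lborel_cbox_eq)
  have "1 \<le> emeasure lebesgue (\<Inter>i\<in>I. G i)" if "card I = 2 * DIM('a)" for I
    using that G[of I] by fastforce
  moreover have "convex (G i)" for i
    by (simp add: G_def)
  ultimately have "ennreal w \<le> emeasure lebesgue (\<Inter>i\<in>{..<2 * DIM('a) + 1}. G i)"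
    using assms unfolding helly_vol_bounds_def by blast
  also have "\<dots> = 1"
    by (rule G) auto
  finally show ?thesis
    by simp
qed

lemma helly_vol_const_le_1: "helly_vol_const TYPE('a::euclidean_space) \<le> 1"
  unfolding helly_vol_const_eq_Sup
proof (rule cSup_least)
  show "helly_vol_bounds TYPE('a) \<noteq> {}"
    using zero_in_helly_vol_bounds by auto
qed (rule helly_vol_bounds_le_1)

lemma helly_vol_const_nonneg: "0 \<le> helly_vol_const TYPE('a::euclidean_space)"
  unfolding helly_vol_const_eq_Sup
proof (rule cSup_upper)
  show "bdd_above (helly_vol_bounds TYPE('a))"
    using helly_vol_bounds_le_1 by (rule bdd_aboveI)
qed (rule zero_in_helly_vol_bounds)

text \<open>Below the supremum there is room for an admissible \<open>w\<close> larger than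
  \<open>v\<close>; this makes the conclusion strict, as the argument with a ball cutting out volume
  exactly \<open>v\<close> requires.\<close>

lemma helly_vol_const_less:
  fixes G :: "nat \<Rightarrow> 'a::euclidean_space set"
  assumes v: "0 \<le> v" "v < helly_vol_const TYPE('a)"
    and G: "\<And>i. i < 2 * DIM('a) + 1 \<Longrightarrow> convex (G i)"
    and sub: "\<And>I. I \<subseteq> {..<2 * DIM('a) + 1} \<Longrightarrow> card I = 2 * DIM('a) \<Longrightarrow>
                emeasure lebesgue (\<Inter>i\<in>I. G i) \<ge> 1"
  shows "ennreal v < emeasure lebesgue (\<Inter>i\<in>{..<2 * DIM('a) + 1}. G i)"
proof -
  obtain w where w: "w \<in> helly_vol_bounds TYPE('a)" "v < w"
    using v(2) zero_in_helly_vol_bounds unfolding helly_vol_const_eq_Sup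
    by (metis empty_iff less_cSupE)
  have "ennreal v < ennreal w"
    using v(1) w(2) by (simp add: ennreal_less_iff)
  also have "\<dots> \<le> emeasure lebesgue (\<Inter>i\<in>{..<2 * DIM('a) + 1}. G i)"
    using w(1) G sub unfolding helly_vol_bounds_def by blast
  finally show ?thesis .
qed

text \<open>Adding the ball to \<open>T\<close> gives \<open>2d + 1\<close> convex sets whose
  intersection has volume only \<open>v\<close>, below w(d). So some \<open>2d\<close> of them meet
  in volume less than 1. These are not the members of \<open>T\<close>, hence they are the ball and
  \<open>2d - 1\<close> members of \<open>T\<close>.\<close>

lemma ex_subfamily_bounded_volume:
  fixes F :: "nat \<Rightarrow> 'a::euclidean_space set"
  assumes v: "0 \<le> v" "v < helly_vol_const TYPE('a)"
    and T: "card T = 2 * DIM('a)" "\<And>i. i \<in> T \<Longrightarrow> convex (F i)"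
      "emeasure lebesgue (\<Inter>i\<in>T. F i) \<ge> 1"
  obtains r S where "0 \<le> r" "S \<subseteq> T" "card S = 2 * DIM('a) - 1"
    "measure lebesgue ((\<Inter>i\<in>T. F i) \<inter> cball 0 r) = v"
    "emeasure lebesgue ((\<Inter>i\<in>S. F i) \<inter> cball 0 r) < 1"
proof -
  have "ennreal v < 1"
    using v helly_vol_const_le_1[where 'a='a] by simp
  then have vT: "ennreal v < emeasure lebesgue (\<Inter>i\<in>T. F i)"
    using T(3) by (rule less_le_trans)
  have convT: "convex (\<Inter>i\<in>T. F i)"
    using T(2) by (intro convex_INT)
  obtain r where r: "0 \<le> r" "measure lebesgue ((\<Inter>i\<in>T. F i) \<inter> cball 0 r) = v"
    using ex_cball_measure_eq[OF convT v(1) vT] by blast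
  have "\<exists>S\<subseteq>T. card S = 2 * DIM('a) - 1 \<and> emeasure lebesgue ((\<Inter>i\<in>S. F i) \<inter> cball 0 r) < 1"
  proof (rule ccontr)
    assume "\<not> ?thesis"
    then have no: "1 \<le> emeasure lebesgue ((\<Inter>i\<in>S. F i) \<inter> cball 0 r)"
      if "S \<subseteq> T" "card S = 2 * DIM('a) - 1" for S
      using that by (meson not_less)
    have "finite T"
      using T(1) by (intro card_ge_0_finite) simp
    then obtain g where g: "bij_betw g {..<2 * DIM('a)} T"
      using T(1) ex_bij_betw_nat_finite by (metis atLeast0LessThan)
    \<comment> \<open>Index \<open>2 * DIM('a)\<close> is the ball; the smaller indices enumerate
      \<open>T\<close>.\<close>
    define G where "G i = (if i < 2 * DIM('a) then F (g i) else cball 0 r)" for i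
    have img: "g ` {..<2 * DIM('a)} = T"
      using g by (simp add: bij_betw_def)
    have full: "(\<Inter>i\<in>{..<2 * DIM('a)}. G i) = (\<Inter>i\<in>T. F i)"
      unfolding G_def img[symmetric] by auto
    have "ennreal v < emeasure lebesgue (\<Inter>i\<in>{..<2 * DIM('a) + 1}. G i)"
    proof (rule helly_vol_const_less[OF v])
      show "convex (G i)" if "i < 2 * DIM('a) + 1" for i
        using img T(2) by (auto simp: G_def)
      show "1 \<le> emeasure lebesgue (\<Inter>i\<in>I. G i)"
        if I: "I \<subseteq> {..<2 * DIM('a) + 1}" "card I = 2 * DIM('a)" for I
      proof (cases "2 * DIM('a) \<in> I")
        case False
        then have "I \<subseteq> {..<2 * DIM('a)}"
          using I(1) less_Suc_eq by auto
        then have "I = {..<2 * DIM('a)}"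
          using I(2) by (intro card_subset_eq) auto
        then show ?thesis
          using full T(3) by simp
      next
        case True
        define I' where "I' = I - {2 * DIM('a)}"
        have I': "I' \<subseteq> {..<2 * DIM('a)}" "I = insert (2 * DIM('a)) I'"
          using I(1) True less_Suc_eq by (auto simp: I'_def)
        have "card I' = 2 * DIM('a) - 1"
          using True I(2) by (simp add: I'_def)
        moreover have "inj_on g I'"
          using g I'(1) by (meson bij_betw_def inj_on_subset)
        ultimately have "card (g ` I') = 2 * DIM('a) - 1"
          by (simp add: card_image)
        moreover have "g ` I' \<subseteq> T"
          using I'(1) img by blast
        moreover have "(\<Inter>i\<in>I. G i) = (\<Inter>i\<in>g ` I'. F i) \<inter> cball 0 r"
          using I'(1) unfolding I'(2) G_def by auto
        ultimately show ?thesis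
          using no by metis
      qed
    qed
    moreover have "(\<Inter>i\<in>{..<2 * DIM('a) + 1}. G i) = (\<Inter>i\<in>T. F i) \<inter> cball 0 r"
      unfolding full[symmetric] by (auto simp: G_def lessThan_Suc)
    moreover have "(\<Inter>i\<in>T. F i) \<inter> cball 0 r \<in> lmeasurable"
      using convT by (intro measurable_convex) (auto intro: convex_Int)
    ultimately show False
      using r(2) by (simp add: emeasure_eq_measure2)
  qed
  then show ?thesis
    using that r by blast
qed

section \<open>The fractional theorem\<close>

text \<open>Combine \<open>k (n choose k) = (n - k + 1) (n choose (k - 1))\<close> with
  \<open>n \<le> k (n - k + 1)\<close>. With \<open>k = 2d\<close> this turns the pigeonhole share
  of a single \<open>(2d - 1)\<close>-set into a number of order \<alpha> n.\<close>

lemma binomial_ratio_bound: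
  assumes "0 < k" "k \<le> n"
  shows "real n * real (n choose (k - 1)) \<le> real k ^ 2 * real (n choose k)"
proof -
  obtain j where j: "k = Suc j"
    using assms(1) gr0_implies_Suc by blast
  have "Suc j * (n choose Suc j) = (n - j) * (n choose j)"
    by (metis binomial_absorb_comp binomial_absorption)
  moreover have "n \<le> Suc j * (n - j)"
  proof -
    obtain m where "n = Suc (j + m)"
      using assms j by (metis add_Suc le_iff_add)
    then show ?thesis
      by simp
  qed
  ultimately have "n * (n choose j) \<le> Suc j * (Suc j * (n choose Suc j))"
    by (metis mult.assoc mult_le_mono1)
  then have "real (n * (n choose j)) \<le> real (Suc j * (Suc j * (n choose Suc j)))"
    by (simp only: of_nat_le_iff)
  then show ?thesis
    unfolding j of_nat_mult power2_eq_square mult.assoc by simp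
qed

theorem theorem1:
  fixes \<epsilon> :: real
  assumes "\<epsilon> > 0"
  shows "\<exists>c0 > (0::real). \<forall>(\<alpha>::real) (n::nat) (F :: nat \<Rightarrow> 'a::euclidean_space set).
     0 < \<alpha> \<and> \<alpha> \<le> 1 \<and> n \<ge> 2 * DIM('a) \<and> (\<forall>i<n. convex (F i)) \<and>
     real (card {I. I \<subseteq> {..<n} \<and> card I = 2 * DIM('a) \<and>
                    emeasure lebesgue (\<Inter>i\<in>I. F i) \<ge> 1})
       \<ge> \<alpha> * real (n choose (2 * DIM('a)))
     \<longrightarrow> (\<exists>J. J \<subseteq> {..<n} \<and> real (card J) \<ge> c0 * \<alpha> * real n \<and>
              emeasure lebesgue (\<Inter>i\<in>J. F i)
                \<ge> ennreal ((1 - \<epsilon>) * helly_vol_const TYPE('a)))"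
proof (cases "\<epsilon> < 1 \<and> 0 < helly_vol_const TYPE('a)")
  \<comment> \<open>Here the required volume is at most 0, so the whole family serves, with constant
    1.\<close>
  case False
  moreover have "0 \<le> helly_vol_const TYPE('a)"
    by (rule helly_vol_const_nonneg)
  ultimately have "(1 - \<epsilon>) * helly_vol_const TYPE('a) \<le> 0"
    by (cases "\<epsilon> < 1") (auto simp: mult_nonpos_nonneg)
  then have "ennreal ((1 - \<epsilon>) * helly_vol_const TYPE('a)) = 0"
    by (rule ennreal_neg)
  moreover have "{..<n} \<subseteq> {..<n} \<and> 1 * \<alpha> * real n \<le> real (card {..<n})" if "\<alpha> \<le> 1" for \<alpha> n
    using that mult_right_mono[of \<alpha> 1 "real n"] by simp
  ultimately show ?thesis
    by (metis zero_less_one zero_le)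
next
  case True
  define d where "d = DIM('a)"
  define w where "w = helly_vol_const TYPE('a)"
  have w: "0 < w" and eps: "0 < \<epsilon>" "\<epsilon> < 1"
    using True assms by (auto simp: w_def)
  have d: "d > 0"
    by (simp add: d_def)
  \<comment> \<open>Half of the allowed loss goes into \<open>v\<close>, the other half into
    shrinking by \<open>1 - s\<close>: Bernoulli's inequality gives
    \<open>(1 - s) ^ d \<ge> 1 - \<epsilon> / 2\<close>, and
    \<open>(1 - \<epsilon> / 2)\<^sup>2 \<ge> 1 - \<epsilon>\<close>.\<close>
  define v where "v = (1 - \<epsilon> / 2) * w"
  have v: "0 < v" "v < w"
    using w eps by (auto simp: v_def)
  define s where "s = \<epsilon> / (2 * real d)"
  have "1 \<le> real d"
    using d by linarith
  then have s: "0 < s" "s < 1"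
    using eps by (auto simp: s_def divide_simps)
  have "1 - \<epsilon> / 2 \<le> (1 - s) ^ d"
    using Bernoulli_inequality[of "- s" d] s d by (simp add: s_def)
  then have "(1 - \<epsilon> / 2) * v \<le> (1 - s) ^ d * v"
    using v by (intro mult_right_mono) auto
  moreover have "(1 - \<epsilon>) * w \<le> (1 - \<epsilon> / 2) * v"
  proof -
    have "(1 - \<epsilon> / 2) * (1 - \<epsilon> / 2) = 1 - \<epsilon> + \<epsilon>\<^sup>2 / 4"
      by (simp add: algebra_simps power2_eq_square)
    then have "(1 - \<epsilon>) * w \<le> ((1 - \<epsilon> / 2) * (1 - \<epsilon> / 2)) * w"
      using w by (intro mult_right_mono) auto
    then show ?thesis
      by (simp add: v_def mult.assoc)
  qed
  ultimately have sv: "(1 - \<epsilon>) * w \<le> (1 - s) ^ d * v"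
    by linarith
  define M :: real where "M = 2 ^ net_size d v s"
  have M0: "M > 0"
    by (simp add: M_def)
  \<comment> \<open>\<open>M\<close> pays for the number of classes, \<open>(2 * d) ^ 2\<close> for
    the ratio of binomial coefficients.\<close>
  define c0 where "c0 = 1 / (M * real (2 * d) ^ 2)"
  have c0: "c0 > 0"
    using M0 d by (simp add: c0_def)
  have main: "\<exists>J. J \<subseteq> {..<n} \<and> real (card J) \<ge> c0 * \<alpha> * real n \<and>
          emeasure lebesgue (\<Inter>i\<in>J. F i) \<ge> ennreal ((1 - \<epsilon>) * w)"
    if \<alpha>: "0 < \<alpha>" "\<alpha> \<le> 1" and n: "2 * d \<le> n" and F: "\<And>i. i < n \<Longrightarrow> convex (F i)"
      and many: "\<alpha> * real (n choose (2 * d)) \<le> real (card {I. I \<subseteq> {..<n} \<and> card I = 2 * d \<and>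
                    emeasure lebesgue (\<Inter>i\<in>I. F i) \<ge> 1})"
    for \<alpha> n and F :: "nat \<Rightarrow> 'a set"
  proof -
    define \<T> where "\<T> = {I. I \<subseteq> {..<n} \<and> card I = 2 * d \<and> emeasure lebesgue (\<Inter>i\<in>I. F i) \<ge> 1}"
    have finT: "finite \<T>"
      by (rule finite_subset[of _ "Pow {..<n}"]) (auto simp: \<T>_def)
    have "\<exists>r S. 0 \<le> r \<and> S \<subseteq> T \<and> card S = 2 * d - 1 \<and>
        measure lebesgue ((\<Inter>i\<in>T. F i) \<inter> cball 0 r) = v \<and>
        emeasure lebesgue ((\<Inter>i\<in>S. F i) \<inter> cball 0 r) < 1" if "T \<in> \<T>" for T
    proof -
      have "\<And>i. i \<in> T \<Longrightarrow> convex (F i)" "card T = 2 * DIM('a)" "emeasure lebesgue (\<Inter>i\<in>T. F i) \<ge> 1"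
        using that F by (auto simp: \<T>_def d_def)
      then show ?thesis
        using ex_subfamily_bounded_volume[of v T F] v unfolding d_def w_def
        by (metis less_eq_real_def)
    qed
    then obtain r S where rS: "\<And>T. T \<in> \<T> \<Longrightarrow> 0 \<le> r T \<and> S T \<subseteq> T \<and> card (S T) = 2 * d - 1 \<and>
        measure lebesgue ((\<Inter>i\<in>T. F i) \<inter> cball 0 (r T)) = v \<and>
        emeasure lebesgue ((\<Inter>i\<in>S T. F i) \<inter> cball 0 (r T)) < 1"
      by metis
    define \<S> where "\<S> = {B. B \<subseteq> {..<n} \<and> card B = 2 * d - 1}"
    have card\<S>: "card \<S> = n choose (2 * d - 1)"
      unfolding \<S>_def by (simp add: n_subsets)
    have pos: "0 < n choose (2 * d)" "0 < n choose (2 * d - 1)"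
      using n by auto
    have "S T \<in> \<S>" if "T \<in> \<T>" for T
      using rS[OF that] that by (auto simp: \<S>_def \<T>_def)
    moreover have "finite \<S>"
      by (rule finite_subset[of _ "Pow {..<n}"]) (auto simp: \<S>_def)
    moreover have "\<S> \<noteq> {}"
      using card\<S> pos(2) by auto
    ultimately have "\<exists>S0\<in>\<S>. card (S -` {S0} \<inter> \<T>) * card \<S> \<ge> card \<T>"
      using finT by (intro pigeonhole_card) auto
    then obtain S0 where S0: "card (S -` {S0} \<inter> \<T>) * card \<S> \<ge> card \<T>"
      by blast
    define I where "I = S -` {S0} \<inter> \<T>"
    have I: "finite I" "I \<subseteq> \<T>"
      using finT by (auto simp: I_def)
    have cI: "\<alpha> * real (n choose (2 * d)) \<le> real (card I) * real (n choose (2 * d - 1))"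
    proof -
      have "\<alpha> * real (n choose (2 * d)) \<le> real (card \<T>)"
        using many by (simp add: \<T>_def)
      also have "\<dots> \<le> real (card I * card \<S>)"
        using S0 unfolding I_def by (simp only: of_nat_le_iff)
      finally show ?thesis
        by (simp add: card\<S>)
    qed
    have "0 < \<alpha> * real (n choose (2 * d))"
      using \<alpha> pos by simp
    with cI have "I \<noteq> {}"
      by auto
    \<comment> \<open>Enlarging every ball to the largest one keeps the volumes at least
      \<open>v\<close>. As \<open>r0\<close> belongs to some \<open>T0\<close> in \<open>I\<close>,
      and \<open>S T0 = S0\<close>, the volume cut from the intersection over \<open>S0\<close> is
      still below 1.\<close>
    define r0 where "r0 = Max (r ` I)"
    have "r0 \<in> r ` I"
      unfolding r0_def using I \<open>I \<noteq> {}\<close> by (intro Max_in) auto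
    then obtain T0 where T0: "T0 \<in> I" "r0 = r T0"
      by blast
    have rle: "r T \<le> r0" if "T \<in> I" for T
      unfolding r0_def using I that by (intro Max_ge) auto
    define A where "A B = (\<Inter>i\<in>B. F i) \<inter> cball 0 r0" for B
    have convA: "convex (A B)" if "B \<subseteq> {..<n}" for B
      unfolding A_def using that F by (intro convex_Int convex_INT) auto
    have bndA: "bounded (A B)" for B
      unfolding A_def by auto
    have measA: "A B \<in> lmeasurable" if "B \<subseteq> {..<n}" for B
      using convA[OF that] bndA by (rule measurable_convex)
    \<comment> \<open>Compact sets are wanted below; passing to closures keeps the volume, since the
      frontier of a convex set is negligible.\<close>
    have clA: "measure lebesgue (closure (A B)) = measure lebesgue (A B)" if "B \<subseteq> {..<n}" for B
      using convA[OF that] bndA by (intro measure_closure negligible_convex_frontier)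
    have In: "T \<subseteq> {..<n}" and SI: "S T = S0" "S0 \<subseteq> T" if "T \<in> I" for T
      using that rS by (auto simp: I_def \<T>_def)
    have S0n: "S0 \<subseteq> {..<n}"
      using In[OF T0(1)] SI[OF T0(1)] by blast
    have "emeasure lebesgue (A S0) < 1"
      using rS[of T0] T0 SI(1)[OF T0(1)] I by (auto simp: A_def)
    then have volS0: "measure lebesgue (A S0) \<le> 1"
      using measA[OF S0n] by (simp add: emeasure_eq_measure2)
    have volT: "v \<le> measure lebesgue (A T)" if "T \<in> I" for T
    proof -
      have conv: "convex (\<Inter>i\<in>T. F i)"
        using In[OF that] F by (intro convex_INT) auto
      have "v = measure lebesgue ((\<Inter>i\<in>T. F i) \<inter> cball 0 (r T))"
        using rS[of T] that I by auto
      also have "\<dots> \<le> measure lebesgue (A T)"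
      proof (rule measure_mono_fmeasurable)
        show "(\<Inter>i\<in>T. F i) \<inter> cball 0 (r T) \<subseteq> A T"
          using rle[OF that] by (auto simp: A_def)
        show "(\<Inter>i\<in>T. F i) \<inter> cball 0 (r T) \<in> sets lebesgue"
          using conv by (intro convex_set_lebesgue convex_Int) auto
      qed (fact measA[OF In[OF that]])
      finally show ?thesis .
    qed
    have sub: "closure (A T) \<subseteq> closure (A S0)" if "T \<in> I" for T
      using SI(2)[OF that] by (intro closure_mono) (auto simp: A_def)
    have clS0: "compact (closure (A S0))" "convex (closure (A S0))"
      "measure lebesgue (closure (A S0)) \<le> 1"
      using bndA S0n volS0 clA[OF S0n] by (auto simp: convA convex_closure)
    have clT: "compact (closure (A T))" "convex (closure (A T))"
      "v \<le> measure lebesgue (closure (A T))" if "T \<in> I" for T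
      using bndA In[OF that] volT[OF that] clA[OF In[OF that]] by (auto simp: convA convex_closure)
    obtain J where J: "J \<subseteq> I" "J \<noteq> {}"
        "real (card I) \<le> 2 ^ net_size (DIM('a)) v s * real (card J)"
      and volJ: "(1 - s) ^ DIM('a) * v \<le> measure lebesgue (\<Inter>T\<in>J. closure (A T))"
      by (rule positive_fraction_large_intersection
            [of v s "closure (A S0)" I "\<lambda>T. closure (A T)", OF v(1) s clS0 I(1) \<open>I \<noteq> {}\<close>
              clT(1,2) sub clT(3)])
    have JM: "real (card I) \<le> M * real (card J)"
      using J(3) by (simp add: M_def d_def)
    define X where "X = \<Union>J"
    have X: "X \<subseteq> {..<n}"
      using J In by (auto simp: X_def)
    have finX: "finite X"
      using X finite_subset by blast
    \<comment> \<open>A tuple in \<open>J\<close> is \<open>S0\<close> with one further index, which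
      determines it; so \<open>X\<close> has at least as many elements as \<open>J\<close>.\<close>
    have "J \<subseteq> (\<lambda>x. insert x S0) ` X"
    proof
      fix T assume T: "T \<in> J"
      then have TI: "T \<in> I"
        using J by blast
      have "card T = 2 * d" "finite T" "card S0 = 2 * d - 1"
        using TI I rS[of T] SI[OF TI] finite_subset[OF In[OF TI]] by (auto simp: \<T>_def)
      then have "card (T - S0) = 1"
        using SI(2)[OF TI] d by (simp add: card_Diff_subset finite_subset)
      then obtain x where "T - S0 = {x}"
        using card_1_singletonE by blast
      then show "T \<in> (\<lambda>x. insert x S0) ` X"
        using SI(2)[OF TI] T by (intro image_eqI[of _ _ x]) (auto simp: X_def)
    qed
    then have JX: "card J \<le> card X"
      using finX by (meson card_image_le card_mono finite_imageI le_trans)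
    have "c0 * \<alpha> * real n \<le> real (card X)"
    proof -
      define p where "p = real (n choose (2 * d - 1))"
      have p: "p > 0"
        using pos by (simp add: p_def)
      have "\<alpha> * real n * p \<le> \<alpha> * (real (2 * d) ^ 2 * real (n choose (2 * d)))"
        using binomial_ratio_bound[of "2 * d" n] d n \<alpha> by (simp add: p_def mult.assoc)
      also have "\<dots> = real (2 * d) ^ 2 * (\<alpha> * real (n choose (2 * d)))"
        by simp
      also have "\<dots> \<le> real (2 * d) ^ 2 * (real (card I) * p)"
        using cI by (intro mult_left_mono) (auto simp: p_def)
      also have "\<dots> = real (2 * d) ^ 2 * real (card I) * p"
        by simp
      finally have "\<alpha> * real n \<le> real (2 * d) ^ 2 * real (card I)"
        using p by simp
      also have "\<dots> \<le> real (2 * d) ^ 2 * (M * real (card X))"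
        using JM JX M0 by (intro mult_left_mono order_trans[OF JM]) auto
      finally show ?thesis
        using M0 d by (simp add: c0_def pos_divide_le_eq mult.commute mult.left_commute)
    qed
    moreover have "ennreal ((1 - \<epsilon>) * w) \<le> emeasure lebesgue (\<Inter>i\<in>X. F i)"
    proof -
      define C where "C = (\<Inter>T\<in>J. closure (A T))"
      \<comment> \<open>A point of \<open>C\<close> outside the null set \<open>N\<close> of
        frontier points lies in every \<open>A T\<close> with \<open>T\<close> in \<open>J\<close>,
        hence in every \<open>F i\<close> with \<open>i\<close> in \<open>X\<close>.\<close>
      define N where "N = (\<Union>T\<in>J. frontier (A T))"
      have convX: "convex (\<Inter>i\<in>X. F i)"
        using X F by (intro convex_INT) auto
      have "finite J"
        using J(1) I(1) finite_subset by blast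
      then have "negligible N"
        unfolding N_def using J In convA by (auto intro!: negligible_Union negligible_convex_frontier)
      then have N: "N \<in> null_sets lebesgue"
        by (simp add: negligible_iff_null_sets)
      have "C \<in> lmeasurable"
        unfolding C_def using J(2) bndA
        by (intro lmeasurable_compact compact_Inter) auto
      then have "ennreal (measure lebesgue C) = emeasure lebesgue C"
        by (simp add: emeasure_eq_measure2)
      also have "\<dots> \<le> emeasure lebesgue ((\<Inter>i\<in>X. F i) \<union> N)"
      proof (rule emeasure_mono)
        show "C \<subseteq> (\<Inter>i\<in>X. F i) \<union> N"
        proof
          fix x assume x: "x \<in> C"
          show "x \<in> (\<Inter>i\<in>X. F i) \<union> N"
          proof (cases "x \<in> N")
            case False
            have "x \<in> A T" if T: "T \<in> J" for T
            proof -
              have "x \<in> closure (A T)" "x \<notin> frontier (A T)"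
                using x T False by (auto simp: C_def N_def)
              then show ?thesis
                using interior_subset[of "A T"] by (auto simp: frontier_def)
            qed
            then show ?thesis
              by (auto simp: X_def A_def)
          qed auto
        qed
        show "(\<Inter>i\<in>X. F i) \<union> N \<in> sets lebesgue"
          using N convex_set_lebesgue[OF convX] by auto
      qed
      also have "\<dots> = emeasure lebesgue (\<Inter>i\<in>X. F i)"
        using N convex_set_lebesgue[OF convX] by (intro emeasure_Un_null_set) auto
      finally show ?thesis
        using volJ sv unfolding C_def d_def by (meson ennreal_leI order_trans)
    qed
    ultimately show ?thesis
      using X by blast
  qed
  show ?thesis
  proof (intro exI[of _ c0] conjI c0 allI impI; elim conjE)
    fix \<alpha> :: real and n :: nat and F :: "nat \<Rightarrow> 'a set"
    assume "0 < \<alpha>" "\<alpha> \<le> 1" "2 * DIM('a) \<le> n" "\<forall>i<n. convex (F i)"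
      "\<alpha> * real (n choose (2 * DIM('a))) \<le> real (card {I. I \<subseteq> {..<n} \<and> card I = 2 * DIM('a) \<and>
                    emeasure lebesgue (\<Inter>i\<in>I. F i) \<ge> 1})"
    then show "\<exists>J. J \<subseteq> {..<n} \<and> real (card J) \<ge> c0 * \<alpha> * real n \<and>
        emeasure lebesgue (\<Inter>i\<in>J. F i) \<ge> ennreal ((1 - \<epsilon>) * helly_vol_const TYPE('a))"
      using main[of \<alpha> n F] by (simp add: d_def w_def)
  qed
qed

end
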